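(* Let $h$ be a positive integer, written uniquely as $h=B+8(A-1)$ with $B\in\{1,\dots,8\}$ and $A\ge 1$ an integer, let $s_a\in\{0,1\}$ be the parity of $A$ ($s_a=1$ if $A$ is odd, $s_a=0$ if $A$ is even), and write $T(h)=B'+8(A'-1)$ with $B'\in\{1,\dots,8\}$ and $A'\ge 1$. Then $B'$ is determined uniquely by the pair $(B,s_a)$, and the mapping $(B,s_a)\mapsto B'$ is exactly the following list of 16 cases. If $s_a=1$ ($A$ odd): $1\mapsto 2$, $2\mapsto 1$, $3\mapsto 5$, $4\mapsto 2$, $5\mapsto 8$, $6\mapsto 3$, $7\mapsto 3$, $8\mapsto 4$. If $s_a=0$ ($A$ even): $1\mapsto 6$, $2\mapsto 5$, $3\mapsto 1$, $4\mapsto 6$, $5\mapsto 4$, $6\mapsto 7$, $7\mapsto 7$, $8\mapsto 8$.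
   Context: The (generalized, accelerated) Collatz map $T$ on positive integers is: writing $h=2k+s$ with $s\in\{0,1\}$, $T(h)=\frac{(2s+1)(2k+s)+s}{2}$, i.e. $T(h)=h/2$ if $h$ is even and $T(h)=(3h+1)/2$ if $h$ is odd. Every positive integer $h$ has a unique base–octave decomposition $h=B+8(A-1)$ with base value $B=((h-1)\bmod 8)+1\in\{1,\dots,8\}$ and octave index $A=1+(h-B)/8\ge 1$. *)

theory Defs imports Main begin

text \<open>The accelerated Collatz map, with \<open>h = 2 k + s\<close>. The numerator is always even,
  so the division is exact. Only positive arguments are of interest.\<close>

definition collatz_T :: "nat \<Rightarrow> nat" where
  "collatz_T h = (let k = h div 2; s = h mod 2
                  in ((2 * s + 1) * (2 * k + s) + s) div 2)"

definition base_octave :: "nat \<Rightarrow> nat \<Rightarrow> nat \<Rightarrow> bool" where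
  "base_octave h B A \<longleftrightarrow> B \<in> {1..8} \<and> 1 \<le> A \<and> h = B + 8 * (A - 1)"

definition octave_parity :: "nat \<Rightarrow> nat" where
  "octave_parity A = (if odd A then 1 else 0)"

lemma collatz_T_even: "even h \<Longrightarrow> collatz_T h = h div 2"
  by (auto simp: collatz_T_def elim!: evenE)

lemma collatz_T_odd: "odd h \<Longrightarrow> collatz_T h = (3 * h + 1) div 2"
  by (auto simp: collatz_T_def elim!: oddE)

lemma collatz_T_pos: "0 < h \<Longrightarrow> 0 < collatz_T h"
  by (cases "even h") (auto simp: collatz_T_even collatz_T_odd elim!: evenE oddE)

lemma base_octave_iff:
  assumes "0 < h"
  shows "base_octave h B A \<longleftrightarrow> B = (h - 1) mod 8 + 1 \<and> A = 1 + (h - B) div 8"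
proof
  assume dec: "base_octave h B A"
  then obtain a where a: "A = Suc a" and h: "h = Suc (B - 1 + 8 * a)" and B: "B - 1 < 8" "1 \<le> B"
    unfolding base_octave_def by (cases A) auto
  have "h - 1 = (B - 1) + 8 * a" using h by (metis diff_Suc_1)
  then have "(h - 1) mod 8 = B - 1" using B(1) by (metis mod_less mod_mult_self2)
  moreover have "(h - B) div 8 = a" using h B by simp
  ultimately show "B = (h - 1) mod 8 + 1 \<and> A = 1 + (h - B) div 8"
    using a B by simp
next
  assume BA: "B = (h - 1) mod 8 + 1 \<and> A = 1 + (h - B) div 8"
  have h: "h - 1 = 8 * ((h - 1) div 8) + (h - 1) mod 8" by simp
  then have "h = B + 8 * ((h - 1) div 8)" using assms BA by linarith
  moreover from this have "(h - B) div 8 = (h - 1) div 8" by simp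
  moreover have "B \<in> {1..8}" using BA mod_less_divisor[of 8 "h - 1"] by simp
  ultimately show "base_octave h B A" using BA by (simp add: base_octave_def)
qed

lemma base_octave_unique: "0 < h \<Longrightarrow> \<exists>!(B, A). base_octave h B A"
  by (auto simp: base_octave_iff)

end

theory Submission imports Defs begin

text \<open>Adding 16 to \<open>h\<close> keeps its parity, so \<open>T\<close> acts on \<open>h\<close> and \<open>h + 16\<close> by the same
  affine branch, of slope \<open>1 / 2\<close> or \<open>3 / 2\<close>. The value therefore grows by 8 or 24, and
  \<open>T h\<close> modulo 8 depends only on \<open>h\<close> modulo 16 (\<open>collatz_T_add_16\<close>). The base value is the
  residue modulo 8 with representatives 1 to 8, while the pair of the base value and the
  parity of the octave index is the residue modulo 16 with representatives 1 to 16. So the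
  successor's base value is a function of that pair (\<open>base_octave_collatz_T\<close>), every pair is
  attained, and the two tables are the values of \<open>T\<close> at the numbers 1 to 8 (odd octave index)
  and 9 to 16 (even octave index), reduced modulo 8.\<close>

lemma collatz_T_add_16:
  "collatz_T (h + 16 * c) = collatz_T h + 8 * ((if even h then 1 else 3) * c)"
  by (cases "even h") (auto simp: collatz_T_even collatz_T_odd elim!: evenE oddE)

text \<open>The least number with base value \<open>B\<close> and octave parity \<open>s\<close>: it lies in the first octave
  if \<open>s = 1\<close> and in the second if \<open>s = 0\<close>.\<close>

definition least_with_base :: "nat \<Rightarrow> nat \<Rightarrow> nat" where
  "least_with_base B s = B + 8 * (1 - s)"

definition next_base :: "nat \<Rightarrow> nat \<Rightarrow> nat" where
  "next_base B s = (collatz_T (least_with_base B s) - 1) mod 8 + 1"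

lemma base_octave_least_with_base:
  assumes "B \<in> {1..8}" and "s \<in> {0, 1}"
  shows "0 < least_with_base B s"
    and "base_octave (least_with_base B s) B (2 - s)"
    and "octave_parity (2 - s) = s"
  using assms by (auto simp: least_with_base_def base_octave_def octave_parity_def)

lemma base_octave_eq_least_add_16:
  assumes "base_octave h B A"
  obtains c where "h = least_with_base B (octave_parity A) + 16 * c"
proof (cases "odd A")
  case True
  then obtain c where "A = 2 * c + 1" by (rule oddE)
  with assms have "h = least_with_base B (octave_parity A) + 16 * c"
    by (simp add: base_octave_def least_with_base_def octave_parity_def)
  then show thesis by (rule that)
next
  case False
  then obtain m where A: "A = 2 * m" by (auto elim: evenE)
  \<comment> \<open>An even octave index is at least 2, which keeps the subtraction below exact.\<close>
  with assms obtain c where "m = Suc c" by (cases m) (auto simp: base_octave_def)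
  with A assms have "h = least_with_base B (octave_parity A) + 16 * c"
    by (simp add: base_octave_def least_with_base_def octave_parity_def)
  then show thesis by (rule that)
qed

text \<open>A number and the least representative of its class modulo 16 have images that agree
  modulo 8, and the residue modulo 8 of an image fixes its base value.\<close>

lemma base_octave_collatz_T:
  assumes "0 < h" and dec: "base_octave h B A"
  shows "(\<exists>A'. base_octave (collatz_T h) B' A') \<longleftrightarrow> B' = next_base B (octave_parity A)"
proof -
  define r where "r = least_with_base B (octave_parity A)"
  obtain c where h: "h = r + 16 * c"
    using base_octave_eq_least_add_16[OF dec] unfolding r_def .
  have "0 < r" using dec by (simp add: r_def least_with_base_def base_octave_def)
  \<comment> \<open>Positivity of \<open>T r\<close> lets the predecessor commute with adding a multiple of 8.\<close>
  then have "0 < collatz_T r" by (rule collatz_T_pos)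
  then have "collatz_T h - 1 = (collatz_T r - 1) + 8 * ((if even r then 1 else 3) * c)"
    unfolding h collatz_T_add_16 by linarith
  then have "(collatz_T h - 1) mod 8 + 1 = next_base B (octave_parity A)"
    by (simp only: next_base_def r_def mod_mult_self2)
  then show ?thesis
    by (simp add: base_octave_iff[OF collatz_T_pos[OF \<open>0 < h\<close>]])
qed

lemma ex1_next_base:
  assumes "B \<in> {1..8}" and "s \<in> {0, 1}"
  shows "\<exists>!B'. \<forall>h A. 0 < h \<and> base_octave h B A \<and> octave_parity A = s \<longrightarrow>
                 (\<exists>A'. base_octave (collatz_T h) B' A')"
proof (rule ex1I[of _ "next_base B s"])
  show "\<forall>h A. 0 < h \<and> base_octave h B A \<and> octave_parity A = s \<longrightarrow>
          (\<exists>A'. base_octave (collatz_T h) (next_base B s) A')"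
    using base_octave_collatz_T by blast
next
  fix B'
  assume "\<forall>h A. 0 < h \<and> base_octave h B A \<and> octave_parity A = s \<longrightarrow>
            (\<exists>A'. base_octave (collatz_T h) B' A')"
  \<comment> \<open>Uniqueness needs the class of \<open>(B, s)\<close> to be inhabited.\<close>
  then have "\<exists>A'. base_octave (collatz_T (least_with_base B s)) B' A'"
    using base_octave_least_with_base[OF assms] by blast
  then show "B' = next_base B s"
    using base_octave_collatz_T base_octave_least_with_base[OF assms] by metis
qed

lemma transitions_eq_graph_next_base:
  assumes "s \<in> {0, 1}"
  shows "{(B, B'). \<exists>h A A'. 0 < h \<and> base_octave h B A \<and> octave_parity A = s \<and>
                      base_octave (collatz_T h) B' A'}
         = (\<lambda>B. (B, next_base B s)) ` {1..8}"
    (is "?transitions = ?graph")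
proof
  show "?transitions \<subseteq> ?graph"
  proof clarify
    fix B B' h A A'
    assume *: "0 < h" "base_octave h B A" "base_octave (collatz_T h) B' A'" "s = octave_parity A"
    then have "B' = next_base B (octave_parity A)" using base_octave_collatz_T by blast
    moreover have "B \<in> {1..8}" using *(2) by (simp add: base_octave_def)
    ultimately show "(B, B') \<in> (\<lambda>B. (B, next_base B (octave_parity A))) ` {1..8}" by blast
  qed
next
  show "?graph \<subseteq> ?transitions"
  proof clarify
    fix B :: nat
    assume "B \<in> {1..8}"
    note least = base_octave_least_with_base[OF this assms]
    then have "\<exists>A'. base_octave (collatz_T (least_with_base B s)) (next_base B s) A'"
      by (simp add: base_octave_collatz_T[OF least(1,2)])
    with least show "\<exists>h A A'. 0 < h \<and> base_octave h B A \<and> octave_parity A = s \<and>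
                       base_octave (collatz_T h) (next_base B s) A'"
      by blast
  qed
qed

lemma atLeastAtMost_1_8: "{1..8} = {1, 2, 3, 4, 5, 6, 7, 8 :: nat}"
  by auto

theorem proposition5p3:
  shows "(\<forall>B\<in>{1..8}. \<forall>s\<in>{0, 1}. \<exists>!B'. \<forall>h A.
            0 < h \<and> base_octave h B A \<and> octave_parity A = s \<longrightarrow>
              (\<exists>A'. base_octave (collatz_T h) B' A'))
       \<and> {(B, B'). \<exists>h A A'. 0 < h \<and> base_octave h B A \<and> octave_parity A = 1 \<and>
                      base_octave (collatz_T h) B' A'}
           = {(1, 2), (2, 1), (3, 5), (4, 2), (5, 8), (6, 3), (7, 3), (8, 4)}
       \<and> {(B, B'). \<exists>h A A'. 0 < h \<and> base_octave h B A \<and> octave_parity A = 0 \<and>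
                      base_octave (collatz_T h) B' A'}
           = {(1, 6), (2, 5), (3, 1), (4, 6), (5, 4), (6, 7), (7, 7), (8, 8)}"
proof (intro conjI ballI)
  fix B s :: nat
  assume "B \<in> {1..8}" and "s \<in> {0, 1}"
  then show "\<exists>!B'. \<forall>h A. 0 < h \<and> base_octave h B A \<and> octave_parity A = s \<longrightarrow>
               (\<exists>A'. base_octave (collatz_T h) B' A')"
    by (rule ex1_next_base)
next
  have "(\<lambda>B. (B, next_base B 1)) ` {1..8} =
          {(1, 2), (2, 1), (3, 5), (4, 2), (5, 8), (6, 3), (7, 3), (8, 4)}"
    unfolding atLeastAtMost_1_8
    by (simp add: next_base_def least_with_base_def collatz_T_def Let_def flip: numeral_2_eq_2)
  then show "{(B, B'). \<exists>h A A'. 0 < h \<and> base_octave h B A \<and> octave_parity A = 1 \<and>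
                 base_octave (collatz_T h) B' A'}
             = {(1, 2), (2, 1), (3, 5), (4, 2), (5, 8), (6, 3), (7, 3), (8, 4)}"
    by (subst transitions_eq_graph_next_base) simp_all
next
  have "(\<lambda>B. (B, next_base B 0)) ` {1..8} =
          {(1, 6), (2, 5), (3, 1), (4, 6), (5, 4), (6, 7), (7, 7), (8, 8)}"
    unfolding atLeastAtMost_1_8
    by (simp add: next_base_def least_with_base_def collatz_T_def Let_def flip: numeral_2_eq_2)
  then show "{(B, B'). \<exists>h A A'. 0 < h \<and> base_octave h B A \<and> octave_parity A = 0 \<and>
                 base_octave (collatz_T h) B' A'}
             = {(1, 6), (2, 5), (3, 1), (4, 6), (5, 4), (6, 7), (7, 7), (8, 8)}"
    by (subst transitions_eq_graph_next_base) simp_all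
qed

end
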